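(* Twisted torus knots and $n$-bridge braids are Lorenz links. Explicitly: (1) for all integers $m\ge 3$, $p\ge 2$, $2\le k\le m-1$, $q\ge 1$, the closure of the braid $(\sigma_{m-1}\sigma_{m-2}\cdots\sigma_1)^p(\sigma_{m-1}\sigma_{m-2}\cdots\sigma_{m-k+1})^{qk}\in B_m$ is a Lorenz link; (2) for all integers $w\ge 3$, $1\le b\le w-2$, $t\ge 2$, $n\ge 1$, the closure of the braid $(\sigma_b\sigma_{b-1}\cdots\sigma_1)^n(\sigma_{w-1}\cdots\sigma_2\sigma_1)^t\in B_w$ is a Lorenz link.
   Context: $B_m$ is the braid group on $m$ strands with Artin generators $\sigma_1,\dots,\sigma_{m-1}$; $\sigma_i$ corresponds to strand $i+1$ crossing over strand $i$. A twisted torus knot is the closure of a braid as in (1); an $n$-bridge braid is the closure of a braid as in (2). A Lorenz link is a link that can be embedded as a finite collection of disjoint simple closed curves on the Lorenz template, the branched 2-complex in $\mathbb{R}^3$ with semiflow having a left and a right band glued along a single branch line, where curves flowing from left to right pass in front of the branch locus and curves flowing from right to left pass behind. By a theorem of Birman and Kofman, the Lorenz links are exactly the T-links, which may be used as the definition: a T-link is a link isotopic to the closure of a positive braid in $B_{p_s}$ of the form $$(\sigma_1\sigma_2\cdots\sigma_{p_1-1})^{q_1}(\sigma_1\sigma_2\cdots\sigma_{p_2-1})^{q_2}\cdots(\sigma_1\sigma_2\cdots\sigma_{p_s-1})^{q_s}$$ with $s\ge 1$, integers $2\le p_1\le p_2\le\cdots\le p_s$, and integers $q_i>0$ for all $i$.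 *)

theory Defs
  imports "HOL-Analysis.Analysis"
begin

text \<open>
  Geometric braids on \<open>m\<close> strands are loops, based at the points \<open>1, \<dots>, m\<close> of the real axis,
  in the space of \<open>m\<close>-element subsets of the complex plane. The generator \<open>\<sigma>\<^sub>i\<close>
  (\<open>1 \<le> i < m\<close>) turns the points \<open>i\<close> and \<open>i + 1\<close> counterclockwise through half a turn about
  their midpoint. The imaginary part is the height towards the observer, so the strand
  starting at \<open>i + 1\<close> passes over the one starting at \<open>i\<close>.
\<close>

definition artin_gen :: "nat \<Rightarrow> nat \<Rightarrow> real \<Rightarrow> complex set" where
  "artin_gen m i s =
     of_nat ` ({1..m} - {i, i + 1}) \<union>
     {of_nat i + 1/2 + cis (pi * s) / 2, of_nat i + 1/2 - cis (pi * s) / 2}"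

lemma artin_gen_endpoints:
  assumes "1 \<le> i" "i < m"
  shows "artin_gen m i 0 = of_nat ` {1..m}" "artin_gen m i 1 = of_nat ` {1..m}"
proof -
  have "{1..m} = ({1..m} - {i, i + 1}) \<union> {i, i + 1}"
    using assms by auto
  then have *: "(of_nat ` {1..m} :: complex set) =
      of_nat ` ({1..m} - {i, i + 1}) \<union> {of_nat i, of_nat i + 1}"
    by (metis image_Un image_insert image_empty of_nat_add of_nat_1)
  show "artin_gen m i 0 = of_nat ` {1..m}" "artin_gen m i 1 = of_nat ` {1..m}"
    unfolding artin_gen_def * by (auto simp: add.commute)
qed

text \<open>
  A list \<open>[i\<^sub>1, \<dots>, i\<^sub>n]\<close> with entries in \<open>{1..<m}\<close> is a word for the positive braid
  \<open>\<sigma>\<^bsub>i\<^sub>1\<^esub> \<cdots> \<sigma>\<^bsub>i\<^sub>n\<^esub>\<close> in the braid group on \<open>m\<close> strands. The geometric braid of the word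
  runs through its letters from left to right, each taking time \<open>1 / n\<close>.
\<close>

definition geometric_braid :: "nat \<Rightarrow> nat list \<Rightarrow> real \<Rightarrow> complex set" where
  "geometric_braid m w t =
     (if w = [] then of_nat ` {1..m}
      else artin_gen m (w ! nat \<lfloor>t * real (length w)\<rfloor>) (frac (t * real (length w))))"

definition word_power :: "nat list \<Rightarrow> nat \<Rightarrow> nat list" where
  "word_power w n = concat (replicate n w)"

text \<open>
  The closed braid about the third coordinate axis: in cylindrical coordinates, a point \<open>z\<close> of
  the configuration at time \<open>t\<close> has radius \<open>Re z\<close> (positive for the braids above), angle
  \<open>2 \<pi> t\<close> and height \<open>Im z\<close>. Time 1 is identified with time 0.
\<close>

definition braid_closure :: "nat \<Rightarrow> nat list \<Rightarrow> (real^3) set" where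
  "braid_closure m w =
     {vector [Re z * cos (2 * pi * t), Re z * sin (2 * pi * t), Im z] | t z.
        0 \<le> t \<and> t < 1 \<and> z \<in> geometric_braid m w t}"

text \<open>Isotopy of unoriented links is ambient isotopy in \<open>\<real>\<^sup>3\<close>.\<close>

definition ambient_isotopic :: "(real^3) set \<Rightarrow> (real^3) set \<Rightarrow> bool" where
  "ambient_isotopic L L' \<longleftrightarrow>
     (\<exists>H :: real \<Rightarrow> real^3 \<Rightarrow> real^3.
        continuous_on ({0..1} \<times> UNIV) (\<lambda>(t, x). H t x) \<and>
        (\<forall>t\<in>{0..1}. \<exists>g. homeomorphism UNIV UNIV (H t) g) \<and>
        (\<forall>x. H 0 x = x) \<and>
        H 1 ` L = L')"

text \<open>The pairs in the list are \<open>(p\<^sub>1, q\<^sub>1), \<dots>, (p\<^sub>s, q\<^sub>s)\<close>.\<close>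

definition T_word :: "(nat \<times> nat) list \<Rightarrow> nat list" where
  "T_word pqs = concat (map (\<lambda>(p, q). word_power [1..<p] q) pqs)"

text \<open>
  Lorenz links are taken to be the T-links (Birman and Kofman). A set ambient isotopic to a
  closed braid is automatically a link, so this need not be required separately.
\<close>

definition Lorenz_link :: "(real^3) set \<Rightarrow> bool" where
  "Lorenz_link L \<longleftrightarrow>
     (\<exists>pqs. pqs \<noteq> [] \<and> sorted (map fst pqs) \<and>
        (\<forall>(p, q)\<in>set pqs. 2 \<le> p \<and> 0 < q) \<and>
        ambient_isotopic L (braid_closure (fst (last pqs)) (T_word pqs)))"

end

theory Submission
  imports Defs
begin

text \<open>
  No braid relation is needed: each of the two closures is carried to the closure of a T-word by
  motions of space that act on positive words in a visible way.
  \<^item> A rotation about the braid axis changes the starting point on the closed braid, so it permutes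
    the letters of the word cyclically (lemma \<open>ambient_isotopic_cyclic\<close>).
  \<^item> A half turn about a line perpendicular to the braid axis makes the closed braid run backwards
    around the axis; as each generator is itself symmetric under this turn, the word is
    reversed (lemma \<open>ambient_isotopic_rev\<close>). Here it is essential that links are not oriented.
  \<^item> A half turn of all the meridian discs of a solid torus that contains the closed braid
    exchanges inner and outer strands, and replaces each letter \<open>\<sigma>\<^sub>i\<close> by \<open>\<sigma>\<close> with index \<open>m - i\<close>
    (lemma \<open>ambient_isotopic_flip\<close>). This is conjugation by the Garside half twist.

  The word of a twisted torus link is flipped to
  \<open>(\<sigma>\<^sub>1 \<cdots> \<sigma>\<^bsub>m-1\<^esub>)\<^sup>p (\<sigma>\<^sub>1 \<cdots> \<sigma>\<^bsub>k-1\<^esub>)\<^bsup>qk\<^esup>\<close>, and the word of an \<open>n\<close>-bridge braid is reversed to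
  \<open>(\<sigma>\<^sub>1 \<cdots> \<sigma>\<^bsub>w-1\<^esub>)\<^sup>t (\<sigma>\<^sub>1 \<cdots> \<sigma>\<^sub>b)\<^sup>n\<close>. In both cases, a cyclic permutation that exchanges the two
  factors gives a T-word.
\<close>

section \<open>Cylindrical coordinates\<close>

text \<open>Angles are measured in full turns, as in the definition of the closed braid.\<close>

definition cyl :: "complex \<Rightarrow> real \<Rightarrow> real^3" where
  "cyl z t = vector [Re z * cos (2 * pi * t), Re z * sin (2 * pi * t), Im z]"

lemma vec3_eq_iff: "x = y \<longleftrightarrow> x$1 = y$1 \<and> x$2 = y$2 \<and> x$3 = y$3" for x y :: "real^3"
  by (simp add: vec_eq_iff forall_3)

lemma cyl_add_nat: "cyl z (t + of_nat n) = cyl z t"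
proof -
  have eq: "2 * pi * (t + of_nat n) = 2 * pi * t + 2 * pi * of_nat n"
    by (rule distrib_left)
  have "cos (2 * pi * of_nat n) = 1" "sin (2 * pi * of_nat n) = 0"
    by (metis cos_int_2pin of_int_of_nat_eq, metis sin_int_2pin of_int_of_nat_eq)
  then show ?thesis
    unfolding cyl_def eq cos_add sin_add by simp
qed

lemma cyl_exhaust:
  obtains z t where "x = cyl z t" "Re z \<ge> 0"
proof -
  obtain r a where r: "r \<ge> 0" "Complex (x$1) (x$2) = rcis r a"
    by (metis rcis_cmod_Arg norm_ge_zero)
  have "x$1 = r * cos a" "x$2 = r * sin a"
    using r(2) by (auto simp: complex_eq_iff)
  then have "x = cyl (Complex r (x$3)) (a / (2 * pi))"
    by (simp add: cyl_def vec3_eq_iff)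
  with r(1) that show thesis by simp
qed

lemma continuous_on_vector3:
  fixes f g h :: "'a::topological_space \<Rightarrow> real"
  assumes "continuous_on S f" "continuous_on S g" "continuous_on S h"
  shows "continuous_on S (\<lambda>x. vector [f x, g x, h x] :: real^3)"
proof -
  have eq: "(vector [f x, g x, h x] :: real^3) =
      (\<chi> i. if i = 1 then f x else if i = 2 then g x else h x)" for x
    by (simp add: vec3_eq_iff)
  show ?thesis
    unfolding eq
  proof (rule continuous_on_vec_lambda)
    fix i :: 3
    show "continuous_on S (\<lambda>x. if i = 1 then f x else if i = 2 then g x else h x)"
      by (cases "i = 1"; cases "i = 2") (simp_all add: assms)
  qed
qed

section \<open>Ambient isotopies\<close>

text \<open>The two isotopies are run simultaneously, which avoids gluing them in time.\<close>

lemma ambient_isotopic_trans: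
  assumes "ambient_isotopic L L'" "ambient_isotopic L' L''"
  shows "ambient_isotopic L L''"
proof -
  obtain H :: "real \<Rightarrow> real^3 \<Rightarrow> real^3" where H: "continuous_on ({0..1} \<times> UNIV) (\<lambda>(t, x). H t x)"
    "\<forall>t\<in>{0..1}. \<exists>g. homeomorphism UNIV UNIV (H t) g"
    "\<forall>x. H 0 x = x" "H 1 ` L = L'"
    using assms(1) unfolding ambient_isotopic_def by (elim exE conjE) (erule (3) that)
  obtain K :: "real \<Rightarrow> real^3 \<Rightarrow> real^3" where K: "continuous_on ({0..1} \<times> UNIV) (\<lambda>(t, x). K t x)"
    "\<forall>t\<in>{0..1}. \<exists>g. homeomorphism UNIV UNIV (K t) g"
    "\<forall>x. K 0 x = x" "K 1 ` L' = L''"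
    using assms(2) unfolding ambient_isotopic_def by (elim exE conjE) (erule (3) that)
  have "continuous_on ({0..1} \<times> UNIV) (\<lambda>p. (fst p, case p of (t, x) \<Rightarrow> H t x))"
    by (intro continuous_intros H(1))
  then have "continuous_on ({0..1} \<times> UNIV)
      (\<lambda>p. case (fst p, case p of (t, x) \<Rightarrow> H t x) of (t, x) \<Rightarrow> K t x)"
    by (rule continuous_on_compose2[OF K(1)]) auto
  then have "continuous_on ({0..1} \<times> UNIV) (\<lambda>(t, x). K t (H t x))"
    by (simp add: case_prod_unfold)
  moreover have "\<exists>g. homeomorphism UNIV UNIV (\<lambda>x. K t (H t x)) g" if "t \<in> {0..1}" for t
    using H(2) K(2) that homeomorphism_compose unfolding o_def by blast
  moreover have "(\<lambda>x. K 1 (H 1 x)) ` L = L''"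
    using H(4) K(4) by (metis image_image)
  ultimately show ?thesis
    unfolding ambient_isotopic_def using H(3) K(3)
    by (intro exI[of _ "\<lambda>t x. K t (H t x)"]) auto
qed

text \<open>
  All motions below belong to families in which the parameters \<open>a\<close> and \<open>- a\<close> give mutually
  inverse maps, and joint continuity in parameter and point makes each of them a homeomorphism.
\<close>

lemma ambient_isotopicI:
  fixes G :: "real \<Rightarrow> real^3 \<Rightarrow> real^3"
  assumes cont: "continuous_on UNIV (\<lambda>(a, x). G a x)"
    and inverse: "\<And>a x. G (- a) (G a x) = x"
    and zero: "\<And>x. G 0 x = x"
    and image: "G a ` L = L'"
  shows "ambient_isotopic L L'"
proof -
  have cont': "continuous_on UNIV (G a)" for a
    using continuous_on_compose2[OF cont, of UNIV "\<lambda>x. (a, x)"]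
    by (simp add: continuous_on_Pair)
  have "homeomorphism UNIV UNIV (G a) (G (- a))" for a
    using inverse[of a] inverse[of "- a"] cont'
    by (auto simp: homeomorphism_def) (metis rangeI)+
  moreover have "continuous_on ({0..1} \<times> UNIV) (\<lambda>p. case (fst p * a, snd p) of (a, x) \<Rightarrow> G a x)"
    by (rule continuous_on_compose2[OF cont]) (auto intro!: continuous_intros)
  ultimately show ?thesis
    unfolding ambient_isotopic_def using zero image
    by (intro exI[of _ "\<lambda>t. G (t * a)"]) (auto simp: case_prod_unfold)
qed

lemma ambient_isotopic_refl: "ambient_isotopic L L"
  by (rule ambient_isotopicI[where G = "\<lambda>a x. x"])
    (simp_all add: case_prod_unfold continuous_on_snd)

section \<open>Closed braids piece by piece\<close>

lemma artin_gen_cnj: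
  "cnj ` artin_gen m i s = artin_gen m i (1 - s)"
proof -
  have "cis (pi * (1 - s)) = - cnj (cis (pi * s))"
    by (simp add: complex_eq_iff algebra_simps cos_diff sin_diff)
  moreover have "cnj ` of_nat ` A = of_nat ` A" for A :: "nat set"
    by (simp add: image_image)
  ultimately show ?thesis
    by (simp add: artin_gen_def image_Un insert_commute)
qed

lemma artin_gen_flip:
  assumes "1 \<le> i" "i < m"
  shows "(\<lambda>z. of_nat (m + 1) - z) ` artin_gen m i s = artin_gen m (m - i) s"
proof -
  have "{1..m} - {m - i, m - i + 1} = (\<lambda>j. m + 1 - j) ` ({1..m} - {i, i + 1})" (is "?A = ?f ` ?B")
  proof
    show "?A \<subseteq> ?f ` ?B"
    proof
      fix j assume "j \<in> ?A"
      then have "m + 1 - j \<in> ?B" "j = ?f (m + 1 - j)" using assms by auto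
      then show "j \<in> ?f ` ?B" by blast
    qed
    show "?f ` ?B \<subseteq> ?A" using assms by auto
  qed
  then have base: "of_nat ` ?A = (\<lambda>z. of_nat (m + 1) - z :: complex) ` of_nat ` ?B"
    by (auto simp: image_image of_nat_diff intro!: image_cong)
  have "of_nat (m + 1) - (of_nat i + 1/2 + u) = of_nat (m - i) + 1/2 - u"
    "of_nat (m + 1) - (of_nat i + 1/2 - u) = of_nat (m - i) + 1/2 + u" for u :: complex
    using assms by (simp_all add: of_nat_diff)
  then show ?thesis
    by (simp only: artin_gen_def image_Un image_insert image_empty base insert_commute)
qed

lemma artin_gen_in_disc:
  assumes "1 \<le> i" "i < m" "z \<in> artin_gen m i s"
  shows "cmod (z - of_real ((real m + 1) / 2)) \<le> (real m - 1) / 2"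
proof -
  consider j where "j \<in> {1..m}" "z = of_nat j"
    | u where "cmod u = 1" "z = of_nat i + 1/2 + u / 2"
  proof -
    from assms(3) consider "z \<in> of_nat ` ({1..m} - {i, i + 1})"
      | "z = of_nat i + 1/2 + cis (pi * s) / 2" | "z = of_nat i + 1/2 + (- cis (pi * s)) / 2"
      unfolding artin_gen_def by auto
    then show thesis
      using that(1) that(2)[of "cis (pi * s)"] that(2)[of "- cis (pi * s)"] by cases auto
  qed
  then show ?thesis
  proof cases
    case 1
    then have "z - of_real ((real m + 1) / 2) = of_real (real j - (real m + 1) / 2)" by simp
    then show ?thesis using 1(1) by (simp only: norm_of_real) (auto simp: abs_le_iff field_simps)
  next
    case 2
    have "z - of_real ((real m + 1) / 2) = of_real (real i - real m / 2) + u / 2"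
      using 2 by (simp add: field_simps)
    then have "cmod (z - of_real ((real m + 1) / 2)) \<le> \<bar>real i - real m / 2\<bar> + 1 / 2"
      using norm_triangle_ineq[of "of_real (real i - real m / 2)" "u / 2"] 2(1)
      by (simp only: norm_of_real norm_divide) simp
    moreover have "1 \<le> real i" "real i + 1 \<le> real m" using assms by linarith+
    then have "\<bar>real i - real m / 2\<bar> \<le> real m / 2 - 1"
      by (simp add: abs_le_iff)
    ultimately show ?thesis by (simp add: diff_divide_distrib)
  qed
qed

text \<open>
  The pieces are taken over closed time intervals and indexed by all natural numbers modulo the
  length of the word. This makes the description symmetric under reversal of time and under
  shifts; the end points agree because every generator starts and ends at the base points.
\<close>

lemma braid_closure_pieces:
  assumes "w \<noteq> []" "set w \<subseteq> {1..<m}"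
  shows "braid_closure m w =
    {cyl z ((of_nat k + s) / length w) | k s z.
       0 \<le> s \<and> s \<le> 1 \<and> z \<in> artin_gen m (w ! (k mod length w)) s}" (is "_ = ?R")
proof
  let ?n = "length w"
  have n: "?n > 0" using assms by simp
  show "braid_closure m w \<subseteq> ?R"
  proof
    fix x assume "x \<in> braid_closure m w"
    then obtain t z where t: "0 \<le> t" "t < 1" and z: "z \<in> geometric_braid m w t" and x: "x = cyl z t"
      unfolding braid_closure_def cyl_def by blast
    define k where "k = nat \<lfloor>t * ?n\<rfloor>"
    have k: "real k = of_int \<lfloor>t * ?n\<rfloor>" using t by (simp add: k_def)
    have "t * ?n < ?n" using t n by simp
    then have "k < ?n" using t by (simp add: k_def nat_less_iff floor_less_iff)
    moreover have "t = (real k + frac (t * ?n)) / ?n"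
      using n by (simp add: k frac_def)
    moreover have "z \<in> artin_gen m (w ! k) (frac (t * ?n))"
      using z assms by (simp add: geometric_braid_def k_def)
    ultimately show "x \<in> ?R"
      unfolding x using frac_ge_0 frac_lt_1[THEN less_imp_le]
      by (intro CollectI exI[of _ k] exI[of _ "frac (t * ?n)"] exI[of _ z]) auto
  qed
  have half_open: "cyl z ((of_nat k + s) / ?n) \<in> braid_closure m w"
    if "0 \<le> s" "s < 1" "z \<in> artin_gen m (w ! (k mod ?n)) s" for k s z
  proof -
    define t where "t = (real (k mod ?n) + s) / ?n"
    have tn: "t * ?n = real (k mod ?n) + s" using n by (simp add: t_def)
    have fl: "\<lfloor>t * ?n\<rfloor> = int (k mod ?n)"
      unfolding tn using that by (intro floor_unique) auto
    then have "frac (t * ?n) = s" by (simp add: frac_def tn)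
    with fl have "z \<in> geometric_braid m w t"
      using that assms by (simp add: geometric_braid_def)
    moreover have "real (k mod ?n) + 1 \<le> ?n"
      using mod_less_divisor[OF n, of k] by linarith
    then have "0 \<le> t" "t < 1"
      using that n unfolding t_def by (simp_all add: field_simps)
    ultimately have "cyl z t \<in> braid_closure m w"
      unfolding braid_closure_def cyl_def by blast
    moreover have "real k = real (k mod ?n) + real ?n * real (k div ?n)"
      by (metis mod_mult_div_eq of_nat_add of_nat_mult)
    then have "(real k + s) / ?n = t + real (k div ?n)"
      using n by (simp add: t_def field_simps)
    ultimately show ?thesis by (simp add: cyl_add_nat)
  qed
  show "?R \<subseteq> braid_closure m w"
  proof clarify
    fix k s z assume s: "0 \<le> s" "s \<le> 1" and z: "z \<in> artin_gen m (w ! (k mod ?n)) s"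
    have letter: "1 \<le> w ! (l mod ?n) \<and> w ! (l mod ?n) < m" for l
      using assms nth_mem[OF mod_less_divisor[OF n]] by fastforce
    show "cyl z ((real k + s) / ?n) \<in> braid_closure m w"
    proof (cases "s < 1")
      case True
      then show ?thesis using half_open s z by blast
    next
      case False
      then have "s = 1" using s by simp
      then have "z \<in> artin_gen m (w ! (Suc k mod ?n)) 0"
        using z letter artin_gen_endpoints by simp
      from half_open[OF _ _ this] show ?thesis by (simp add: \<open>s = 1\<close> add.commute)
    qed
  qed
qed

section \<open>Rotations: cyclic permutation and reversal of words\<close>

definition rotate_axis3 :: "real \<Rightarrow> real^3 \<Rightarrow> real^3" where
  "rotate_axis3 a x = vector [cos a * x$1 - sin a * x$2, sin a * x$1 + cos a * x$2, x$3]"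

definition rotate_axis1 :: "real \<Rightarrow> real^3 \<Rightarrow> real^3" where
  "rotate_axis1 a x = vector [x$1, cos a * x$2 - sin a * x$3, sin a * x$2 + cos a * x$3]"

lemma rotate_axis3_cyl: "rotate_axis3 (2 * pi * b) (cyl z t) = cyl z (t + b)"
  by (simp add: rotate_axis3_def cyl_def vec3_eq_iff cos_add sin_add algebra_simps)

lemma rotate_axis1_pi_cyl: "rotate_axis1 pi (cyl z t) = cyl (cnj z) (- t)"
  by (simp add: rotate_axis1_def cyl_def vec3_eq_iff)

lemma rotation_inverse:
  "cos a * (cos a * u - sin a * v) + sin a * (sin a * u + cos a * v) = u"
  "cos a * (sin a * u + cos a * v) - sin a * (cos a * u - sin a * v) = v" for a u v :: real
proof -
  have "cos a * (cos a * u - sin a * v) + sin a * (sin a * u + cos a * v) =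
      ((sin a)\<^sup>2 + (cos a)\<^sup>2) * u"
    "cos a * (sin a * u + cos a * v) - sin a * (cos a * u - sin a * v) =
      ((sin a)\<^sup>2 + (cos a)\<^sup>2) * v"
    by (simp_all add: power2_eq_square algebra_simps
        del: sin_cos_squared_add sin_cos_squared_add2 sin_cos_squared_add3)
  then show "cos a * (cos a * u - sin a * v) + sin a * (sin a * u + cos a * v) = u"
    "cos a * (sin a * u + cos a * v) - sin a * (cos a * u - sin a * v) = v"
    by simp_all
qed

lemma ambient_isotopic_rotate_axis3: "ambient_isotopic L (rotate_axis3 a ` L)"
proof (rule ambient_isotopicI)
  show "continuous_on UNIV (\<lambda>(a, x). rotate_axis3 a x)"
    unfolding rotate_axis3_def case_prod_unfold
    by (intro continuous_on_vector3 continuous_intros)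
qed (auto simp: rotate_axis3_def vec3_eq_iff rotation_inverse)

lemma ambient_isotopic_rotate_axis1: "ambient_isotopic L (rotate_axis1 a ` L)"
proof (rule ambient_isotopicI)
  show "continuous_on UNIV (\<lambda>(a, x). rotate_axis1 a x)"
    unfolding rotate_axis1_def case_prod_unfold
    by (intro continuous_on_vector3 continuous_intros)
qed (auto simp: rotate_axis1_def vec3_eq_iff rotation_inverse)

lemma ambient_isotopic_cyclic:
  assumes "set (u @ v) \<subseteq> {1..<m}"
  shows "ambient_isotopic (braid_closure m (u @ v)) (braid_closure m (v @ u))"
proof (cases "u @ v = []")
  case True
  then show ?thesis by (simp add: ambient_isotopic_refl)
next
  case False
  define w where "w = v @ u"
  define n where "n = length w"
  define j where "j = length v"
  have uv: "u @ v = rotate j w" by (simp add: w_def j_def rotate_append)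
  have w: "w \<noteq> []" "set w \<subseteq> {1..<m}" using False assms by (auto simp: w_def)
  then have n: "n > 0" by (simp add: n_def)
  have letter: "(u @ v) ! (k mod n) = w ! ((j + k) mod n)" for k
    using n by (simp add: uv nth_rotate n_def mod_add_right_eq)
  have C: "braid_closure m w = {cyl z ((of_nat k + s) / n) | k s z.
       0 \<le> s \<and> s \<le> 1 \<and> z \<in> artin_gen m (w ! (k mod n)) s}"
    using braid_closure_pieces[OF w] by (simp add: n_def)
  have D: "braid_closure m (u @ v) = {cyl z ((of_nat k + s) / n) | k s z.
       0 \<le> s \<and> s \<le> 1 \<and> z \<in> artin_gen m (w ! ((j + k) mod n)) s}"
  proof -
    have "length (u @ v) = n" by (simp add: n_def w_def)
    then show ?thesis
      using braid_closure_pieces[OF False assms] letter by simp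
  qed
  have "rotate_axis3 (2 * pi * (j / n)) ` braid_closure m (u @ v) = braid_closure m w"
  proof
    show "rotate_axis3 (2 * pi * (j / n)) ` braid_closure m (u @ v) \<subseteq> braid_closure m w"
    proof clarify
      fix x assume "x \<in> braid_closure m (u @ v)"
      then obtain k s z where *: "x = cyl z ((of_nat k + s) / n)" "0 \<le> s" "s \<le> 1"
        "z \<in> artin_gen m (w ! ((j + k) mod n)) s"
        unfolding D by blast
      have "rotate_axis3 (2 * pi * (j / n)) x = cyl z ((of_nat (j + k) + s) / n)"
        unfolding *(1) rotate_axis3_cyl by (simp add: add_divide_distrib[symmetric] algebra_simps)
      then show "rotate_axis3 (2 * pi * (j / n)) x \<in> braid_closure m w"
        unfolding C using * by blast
    qed
    show "braid_closure m w \<subseteq> rotate_axis3 (2 * pi * (j / n)) ` braid_closure m (u @ v)"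
    proof
      fix x assume "x \<in> braid_closure m w"
      then obtain k s z where *: "x = cyl z ((of_nat k + s) / n)" "0 \<le> s" "s \<le> 1"
        "z \<in> artin_gen m (w ! (k mod n)) s"
        unfolding C by blast
      \<comment> \<open>The shift by \<open>j\<close> is undone modulo \<open>n\<close> by a shift by \<open>(n - 1) * j\<close>, which stays in the
        natural numbers.\<close>
      define l where "l = k + (n - 1) * j"
      have "n * j = (n - 1) * j + j" using n by (cases n) simp_all
      then have l: "j + l = k + n * j" by (simp add: l_def)
      then have "real l + real j = real k + real n * real j"
        by (metis add.commute of_nat_add of_nat_mult)
      then have "(real l + s) / n + j / n = (real k + s) / n + real j"
        using n by (simp add: field_simps)
      then have "x = rotate_axis3 (2 * pi * (j / n)) (cyl z ((of_nat l + s) / n))"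
        unfolding rotate_axis3_cyl *(1) by (simp add: cyl_add_nat)
      moreover have "z \<in> artin_gen m (w ! ((j + l) mod n)) s"
        using *(4) by (simp add: l)
      then have "cyl z ((of_nat l + s) / n) \<in> braid_closure m (u @ v)"
        unfolding D using * by blast
      ultimately show "x \<in> rotate_axis3 (2 * pi * (j / n)) ` braid_closure m (u @ v)"
        by blast
    qed
  qed
  then show ?thesis
    using ambient_isotopic_rotate_axis3 unfolding w_def by metis
qed

text \<open>
  The half turn maps the point \<open>z\<close> at angle \<open>t\<close> to the complex conjugate of \<open>z\<close> at angle
  \<open>- t\<close>. A generator read backwards in time and conjugated is the same generator: the reversal
  and the reflection each change the sense of the crossing.
\<close>

lemma ambient_isotopic_rev:
  assumes "set w \<subseteq> {1..<m}"
  shows "ambient_isotopic (braid_closure m w) (braid_closure m (rev w))"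
proof (cases "w = []")
  case True
  then show ?thesis by (simp add: ambient_isotopic_refl)
next
  case False
  have sub: "rotate_axis1 pi ` braid_closure m w \<subseteq> braid_closure m (rev w)"
    if w: "w \<noteq> []" "set w \<subseteq> {1..<m}" for w
  proof clarify
    let ?n = "length w"
    fix x assume "x \<in> braid_closure m w"
    then obtain k s z where *: "x = cyl z ((of_nat k + s) / ?n)" "0 \<le> s" "s \<le> 1"
      "z \<in> artin_gen m (w ! (k mod ?n)) s"
      unfolding braid_closure_pieces[OF w] by blast
    have n: "?n > 0" using w by simp
    define l where "l = ?n - 1 - k mod ?n"
    have kn: "k mod ?n < ?n" using n by simp
    have l: "l < ?n" "?n - Suc l = k mod ?n"
      using kn unfolding l_def by linarith+
    then have letter: "rev w ! (l mod ?n) = w ! (k mod ?n)"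
      by (simp add: rev_nth)
    have "real l + 1 + real (k mod ?n) = ?n"
      using kn unfolding l_def by linarith
    moreover have "real k = real (k mod ?n) + real ?n * real (k div ?n)"
      by (metis mod_mult_div_eq of_nat_add of_nat_mult)
    ultimately have "(real l + (1 - s)) / ?n = - ((real k + s) / ?n) + of_nat (Suc (k div ?n))"
      using n by (simp add: field_simps)
    then have "rotate_axis1 pi x = cyl (cnj z) ((real l + (1 - s)) / length (rev w))"
      by (simp only: *(1) rotate_axis1_pi_cyl cyl_add_nat length_rev)
    moreover have "cnj z \<in> artin_gen m (rev w ! (l mod length (rev w))) (1 - s)"
      using *(4) letter artin_gen_cnj[of m _ s] by (metis imageI length_rev)
    moreover have "0 \<le> 1 - s" "1 - s \<le> 1" using * by auto
    moreover have "rev w \<noteq> []" "set (rev w) \<subseteq> {1..<m}" using w by auto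
    ultimately show "rotate_axis1 pi x \<in> braid_closure m (rev w)"
      using braid_closure_pieces[of "rev w" m] by blast
  qed
  have "rotate_axis1 pi (rotate_axis1 pi x) = x" for x
    by (simp add: rotate_axis1_def vec3_eq_iff)
  then have "braid_closure m (rev w) \<subseteq> rotate_axis1 pi ` braid_closure m w"
    using sub[of "rev w"] False assms by (metis image_eqI image_subset_iff rev_is_Nil_conv rev_rev_ident set_rev subsetI)
  then have "rotate_axis1 pi ` braid_closure m w = braid_closure m (rev w)"
    using sub False assms by blast
  then show ?thesis
    using ambient_isotopic_rotate_axis1 by metis
qed

section \<open>Meridional twists: flipping words\<close>

text \<open>
  The centre of the meridian disc is the barycentre of the base points. The closed braid lies in
  the disc of radius \<open>(m - 1) / 2\<close>, which is turned rigidly. The twist fades out at radius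
  \<open>m / 2\<close>, which keeps the distance \<open>1 / 2\<close> from the braid axis.
\<close>

definition twist_disc :: "nat \<Rightarrow> real \<Rightarrow> complex \<Rightarrow> complex" where
  "twist_disc m a z =
     (let c = of_real ((real m + 1) / 2)
      in c + cis (a * max 0 (min 1 (real m - 2 * cmod (z - c)))) * (z - c))"

text \<open>
  In the first two coordinates, the radius is multiplied by the quotient of new and old radius.
  This quotient is written with the denominator cut off at \<open>1 / 2\<close>: that changes nothing where
  the twist moves points, and makes continuity on the braid axis obvious.
\<close>

definition twist_torus :: "nat \<Rightarrow> real \<Rightarrow> real^3 \<Rightarrow> real^3" where
  "twist_torus m a x =
     (let r = sqrt ((x$1)\<^sup>2 + (x$2)\<^sup>2);
          z = twist_disc m a (Complex r (x$3));
          q = 1 + (Re z - r) / max r (1/2)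
      in vector [q * x$1, q * x$2, Im z])"

lemma cmod_twist_disc:
  "cmod (twist_disc m a z - of_real ((real m + 1) / 2)) = cmod (z - of_real ((real m + 1) / 2))"
  by (simp add: twist_disc_def Let_def norm_mult)

lemma twist_disc_inverse: "twist_disc m (- a) (twist_disc m a z) = z"
proof -
  define c :: complex where "c = of_real ((real m + 1) / 2)"
  define e where "e = max 0 (min 1 (real m - 2 * cmod (z - c)))"
  have twist: "twist_disc m a z = c + cis (a * e) * (z - c)"
    by (simp add: twist_disc_def Let_def c_def e_def)
  have "twist_disc m (- a) (twist_disc m a z) = c + cis (- a * e) * (twist_disc m a z - c)"
    unfolding twist_disc_def[of m "- a"] Let_def c_def[symmetric]
    by (simp only: cmod_twist_disc[of m a z, folded c_def] e_def)
  also have "\<dots> = z"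
    by (simp add: twist cis_mult flip: mult.assoc)
  finally show ?thesis .
qed

lemma twist_disc_outside:
  assumes "Re z \<le> 1/2"
  shows "twist_disc m a z = z"
proof -
  define c :: complex where "c = of_real ((real m + 1) / 2)"
  have "(real m + 1) / 2 - Re z \<le> cmod (z - c)"
    using abs_Re_le_cmod[of "z - c"] by (simp add: c_def)
  then have "real m - 2 * cmod (z - c) \<le> 0"
    using assms by (simp add: field_simps)
  then show ?thesis by (simp add: twist_disc_def Let_def c_def)
qed

text \<open>
  If the image had real part at most \<open>1 / 2\<close>, it would be fixed by the inverse twist and hence
  coincide with \<open>z\<close>.
\<close>

lemma Re_twist_disc:
  assumes "Re z > 1/2"
  shows "Re (twist_disc m a z) > 1/2"
  using assms twist_disc_outside[of "twist_disc m a z" m "- a"] twist_disc_inverse[of m a z]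
  by force

lemma twist_torus_cyl:
  assumes "Re z \<ge> 0"
  shows "twist_torus m a (cyl z t) = cyl (twist_disc m a z) t"
proof -
  have "(Re z * cos (2 * pi * t))\<^sup>2 + (Re z * sin (2 * pi * t))\<^sup>2 = (Re z)\<^sup>2"
    by (simp add: power_mult_distrib flip: distrib_left)
  then have r: "sqrt ((cyl z t $ 1)\<^sup>2 + (cyl z t $ 2)\<^sup>2) = Re z"
    using assms by (simp add: cyl_def)
  have z: "Complex (Re z) (cyl z t $ 3) = z" by (simp add: cyl_def)
  have "(1 + (Re (twist_disc m a z) - Re z) / max (Re z) (1/2)) * Re z = Re (twist_disc m a z)"
  proof (cases "Re z \<le> 1/2")
    case True
    then show ?thesis by (simp add: twist_disc_outside)
  next
    case False
    then show ?thesis by (simp add: field_simps max_def)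
  qed
  then show ?thesis
    unfolding twist_torus_def Let_def r z
    by (simp add: cyl_def vec3_eq_iff flip: mult.assoc)
qed

lemma ambient_isotopic_twist_torus: "ambient_isotopic L (twist_torus m a ` L)"
proof (rule ambient_isotopicI)
  have "max r (1/2) \<noteq> 0" for r :: real by simp
  then show "continuous_on UNIV (\<lambda>(a, x). twist_torus m a x)"
    unfolding twist_torus_def twist_disc_def Let_def case_prod_unfold Complex_eq
    by (intro continuous_on_vector3 continuous_intros) auto
next
  fix a x
  obtain z t where z: "x = cyl z t" "Re z \<ge> 0" by (rule cyl_exhaust)
  have "Re (twist_disc m a z) \<ge> 0"
    using z(2) Re_twist_disc[of z m a] twist_disc_outside[of z m a] by fastforce
  then show "twist_torus m (- a) (twist_torus m a x) = x"
    by (simp add: z twist_torus_cyl twist_disc_inverse)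
next
  show "twist_torus m 0 x = x" for x
    by (rule cyl_exhaust[of x]) (simp add: twist_torus_cyl twist_disc_def)
qed simp

text \<open>
  On the disc containing the strands, the parameter \<open>\<pi>\<close> gives the half turn
  \<open>z \<mapsto> (m + 1) - z\<close>, which maps \<open>\<sigma>\<^sub>i\<close> to the generator with index \<open>m - i\<close>. Its sense is kept, since a half turn preserves
  orientation.
\<close>

lemma ambient_isotopic_flip:
  assumes "set w \<subseteq> {1..<m}"
  shows "ambient_isotopic (braid_closure m w) (braid_closure m (map (\<lambda>i. m - i) w))"
proof (cases "w = []")
  case True
  then show ?thesis by (simp add: ambient_isotopic_refl)
next
  case False
  let ?n = "length w" and ?w = "map (\<lambda>i. m - i) w"
  have n: "?n > 0" using False by simp
  have "\<forall>i\<in>set w. 1 \<le> i \<and> i < m" using assms by auto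
  then have w': "?w \<noteq> []" "set ?w \<subseteq> {1..<m}" using False by auto
  have letter: "1 \<le> w ! (k mod ?n) \<and> w ! (k mod ?n) < m" for k
    using assms nth_mem[OF mod_less_divisor[OF n]] by fastforce
  have letter': "?w ! (k mod ?n) = m - w ! (k mod ?n)" for k
    using n by simp
  have turn: "twist_torus m pi (cyl z t) = cyl (of_nat (m + 1) - z) t"
    if "z \<in> artin_gen m i s" "1 \<le> i" "i < m" for z i s t
  proof -
    let ?c = "of_real ((real m + 1) / 2) :: complex"
    have d: "cmod (z - ?c) \<le> (real m - 1) / 2"
      using artin_gen_in_disc that by blast
    then have "min 1 (real m - 2 * cmod (z - ?c)) = 1" by simp
    then have "twist_disc m pi z = ?c + cis pi * (z - ?c)"
      unfolding twist_disc_def Let_def by simp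
    also have "\<dots> = of_nat (m + 1) - z" by (simp add: field_simps)
    finally have "twist_disc m pi z = of_nat (m + 1) - z" .
    moreover have "Re z \<ge> 0"
      using d abs_Re_le_cmod[of "z - ?c"] by (simp add: abs_le_iff field_simps)
    ultimately show ?thesis by (simp add: twist_torus_cyl)
  qed
  have "twist_torus m pi ` braid_closure m w = braid_closure m ?w"
  proof
    show "twist_torus m pi ` braid_closure m w \<subseteq> braid_closure m ?w"
    proof clarify
      fix x assume "x \<in> braid_closure m w"
      then obtain k s z where *: "x = cyl z ((of_nat k + s) / ?n)" "0 \<le> s" "s \<le> 1"
        "z \<in> artin_gen m (w ! (k mod ?n)) s"
        unfolding braid_closure_pieces[OF False assms] by blast
      have "of_nat (m + 1) - z \<in> artin_gen m (?w ! (k mod ?n)) s"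
        using *(4) letter artin_gen_flip unfolding letter' by blast
      then show "twist_torus m pi x \<in> braid_closure m ?w"
        using * turn[OF *(4)] letter braid_closure_pieces[OF w'] by auto
    qed
    show "braid_closure m ?w \<subseteq> twist_torus m pi ` braid_closure m w"
    proof
      fix x assume "x \<in> braid_closure m ?w"
      then obtain k s z' where *: "x = cyl z' ((of_nat k + s) / ?n)" "0 \<le> s" "s \<le> 1"
        "z' \<in> artin_gen m (?w ! (k mod ?n)) s"
        unfolding braid_closure_pieces[OF w'] by auto
      then obtain z where z: "z \<in> artin_gen m (w ! (k mod ?n)) s" "z' = of_nat (m + 1) - z"
        using letter artin_gen_flip unfolding letter' by blast
      then have "x = twist_torus m pi (cyl z ((of_nat k + s) / ?n))"
        using turn[OF z(1)] letter * by simp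
      moreover have "cyl z ((of_nat k + s) / ?n) \<in> braid_closure m w"
        unfolding braid_closure_pieces[OF False assms] using * z by blast
      ultimately show "x \<in> twist_torus m pi ` braid_closure m w" by blast
    qed
  qed
  then show ?thesis
    using ambient_isotopic_twist_torus by metis
qed

section \<open>Lorenz links\<close>

lemma map_word_power: "map f (word_power w n) = word_power (map f w) n"
  by (simp add: word_power_def map_concat)

lemma rev_word_power: "rev (word_power w n) = word_power (rev w) n"
  by (simp add: word_power_def rev_concat)

lemma set_word_power: "set (word_power w n) \<subseteq> set w"
  by (auto simp: word_power_def)

lemma map_flip_rev_upt:
  assumes "1 \<le> j" "j \<le> m"
  shows "map (\<lambda>i. m - i) (rev [j..<m]) = [1..<m - j + 1]"
  using assms by (intro nth_equalityI) (auto simp: rev_nth simp del: upt_Suc)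

text \<open>T-words with two factors suffice; the factors appear here in cyclically permuted order.\<close>

lemma Lorenz_link_if_isotopic_to_two_factors:
  assumes "ambient_isotopic L (braid_closure p (word_power [1..<p] t @ word_power [1..<k] n))"
    and "2 \<le> k" "k \<le> p" "0 < t" "0 < n"
  shows "Lorenz_link L"
proof -
  have "set (word_power [1..<p] t @ word_power [1..<k] n) \<subseteq> {1..<p}"
    using set_word_power[of "[1..<p]" t] set_word_power[of "[1..<k]" n] assms(3) by auto
  from ambient_isotopic_trans[OF assms(1) ambient_isotopic_cyclic[OF this]]
  show ?thesis
    unfolding Lorenz_link_def using assms
    by (intro exI[of _ "[(k, n), (p, t)]"]) (auto simp: T_word_def)
qed

theorem lemma3p3:
  "(\<forall>m p k q :: nat. 3 \<le> m \<and> 2 \<le> p \<and> 2 \<le> k \<and> k \<le> m - 1 \<and> 1 \<le> q \<longrightarrow>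
      Lorenz_link (braid_closure m
        (word_power (rev [1..<m]) p @ word_power (rev [m - k + 1..<m]) (q * k)))) \<and>
   (\<forall>w b t n :: nat. 3 \<le> w \<and> 1 \<le> b \<and> b \<le> w - 2 \<and> 2 \<le> t \<and> 1 \<le> n \<longrightarrow>
      Lorenz_link (braid_closure w
        (word_power (rev [1..<b + 1]) n @ word_power (rev [1..<w]) t)))"
proof (intro conjI allI impI)
  fix m p k q :: nat
  assume *: "3 \<le> m \<and> 2 \<le> p \<and> 2 \<le> k \<and> k \<le> m - 1 \<and> 1 \<le> q"
  let ?w = "word_power (rev [1..<m]) p @ word_power (rev [m - k + 1..<m]) (q * k)"
  have "set ?w \<subseteq> {1..<m}"
    using set_word_power[of "rev [1..<m]" p] set_word_power[of "rev [m - k + 1..<m]" "q * k"]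
    by auto
  moreover have "map (\<lambda>i. m - i) ?w = word_power [1..<m] p @ word_power [1..<k] (q * k)"
  proof -
    have "map (\<lambda>i. m - i) (rev [1..<m]) = [1..<m]"
      using * map_flip_rev_upt[of 1 m] by (simp del: upt_Suc)
    moreover have "m - k + 1 \<le> m" "m - (m - k + 1) + 1 = k"
      using * by linarith+
    then have "map (\<lambda>i. m - i) (rev [m - k + 1..<m]) = [1..<k]"
      using map_flip_rev_upt[of "m - k + 1" m] by simp
    ultimately show ?thesis
      by (simp only: map_append map_word_power)
  qed
  ultimately have "ambient_isotopic (braid_closure m ?w)
      (braid_closure m (word_power [1..<m] p @ word_power [1..<k] (q * k)))"
    using ambient_isotopic_flip by metis
  then show "Lorenz_link (braid_closure m ?w)"
    by (rule Lorenz_link_if_isotopic_to_two_factors) (use * in auto)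
next
  fix w b t n :: nat
  assume *: "3 \<le> w \<and> 1 \<le> b \<and> b \<le> w - 2 \<and> 2 \<le> t \<and> 1 \<le> n"
  let ?w = "word_power (rev [1..<b + 1]) n @ word_power (rev [1..<w]) t"
  have "set ?w \<subseteq> set (rev [1..<b + 1]) \<union> set (rev [1..<w])"
    unfolding set_append by (intro Un_mono set_word_power)
  also have "\<dots> \<subseteq> {1..<w}"
    using * by auto
  finally have "set ?w \<subseteq> {1..<w}" .
  moreover have "rev ?w = word_power [1..<w] t @ word_power [1..<b + 1] n"
    by (simp only: rev_append rev_word_power rev_rev_ident)
  ultimately have "ambient_isotopic (braid_closure w ?w)
      (braid_closure w (word_power [1..<w] t @ word_power [1..<b + 1] n))"
    using ambient_isotopic_rev by metis
  then show "Lorenz_link (braid_closure w ?w)"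
    by (rule Lorenz_link_if_isotopic_to_two_factors) (use * in auto)
qed

end
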